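(* Let $0<q<p$ be real and let $a$ be a real number. For every $s>0$ with $s>\left|\frac aq\right|$, $$\mathcal L_{p,q}\{E_{p,q}(at)\}(s)=\frac q{qs-a}.$$
   Context: Let $0<q<p$ be real numbers. For an integer $n\ge 0$, $[n]_{p,q}=\frac{p^n-q^n}{p-q}$, $[n]_{p,q}!=\prod_{k=1}^n[k]_{p,q}$, $[0]_{p,q}!=1$. The $(p,q)$-exponentials are $E_{p,q}(z)=\sum_{n\ge0}\frac{q^{\binom n2}}{[n]_{p,q}!}z^n$ (entire) and $e_{p,q}(z)=\sum_{n\ge0}\frac{p^{\binom n2}}{[n]_{p,q}!}z^n$; the latter series converges for $|z|<p/(p-q)$ and $e_{p,q}$ is extended meromorphically to $\mathbb C$ by $e_{p,q}(z)=1/E_{p,q}(-z)$. The improper $(p,q)$-integral of $f$ is $\int_0^\infty f(x)\,d_{p,q}x=(p-q)\sum_{j=-\infty}^{\infty}\frac{q^j}{p^{j+1}}f\!\left(\frac{q^j}{p^{j+1}}\right)$; it converges if both the sum over $j\ge0$ and the sum over $j<0$ converge. The $(p,q)$-Laplace transform of the second kind is $\mathcal L_{p,q}\{f(t)\}(s)=\int_0^\infty f(t)e_{p,q}(-pts)\,d_{p,q}t$, $s>0$. *)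

theory Defs
  imports Complex_Main
begin

definition pq_bracket :: "real \<Rightarrow> real \<Rightarrow> nat \<Rightarrow> real" where
  "pq_bracket p q n = (p ^ n - q ^ n) / (p - q)"

definition pq_fact :: "real \<Rightarrow> real \<Rightarrow> nat \<Rightarrow> real" where
  "pq_fact p q n = (\<Prod>k = 1..n. pq_bracket p q k)"

definition pq_E :: "real \<Rightarrow> real \<Rightarrow> complex \<Rightarrow> complex" where
  "pq_E p q z = (\<Sum>n. complex_of_real (q ^ (n choose 2) / pq_fact p q n) * z ^ n)"

definition pq_e_series :: "real \<Rightarrow> real \<Rightarrow> complex \<Rightarrow> complex" where
  "pq_e_series p q z = (\<Sum>n. complex_of_real (p ^ (n choose 2) / pq_fact p q n) * z ^ n)"

(* The series on its disc of convergence, and its meromorphic extension outside.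
   At a pole the value is 0 (division by zero); for 0 < q < p the poles all lie on the
   positive real axis. *)
definition pq_e :: "real \<Rightarrow> real \<Rightarrow> complex \<Rightarrow> complex" where
  "pq_e p q z =
     (if norm z < p / (p - q) then pq_e_series p q z else 1 / pq_E p q (- z))"

definition pq_node :: "real \<Rightarrow> real \<Rightarrow> int \<Rightarrow> real" where
  "pq_node p q j = q powi j / p powi (j + 1)"

definition pq_summand ::
  "real \<Rightarrow> real \<Rightarrow> (real \<Rightarrow> 'a::real_normed_vector) \<Rightarrow> int \<Rightarrow> 'a" where
  "pq_summand p q f j = pq_node p q j *\<^sub>R f (pq_node p q j)"

(* The two halves of the bilateral sum are ordinary (not necessarily absolutely convergent)
   series: j = n for the indices j >= 0, and j = - n - 1 for the indices j < 0. *)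
definition pq_integrable ::
  "real \<Rightarrow> real \<Rightarrow> (real \<Rightarrow> 'a::real_normed_vector) \<Rightarrow> bool" where
  "pq_integrable p q f \<longleftrightarrow>
     summable (\<lambda>n. pq_summand p q f (int n)) \<and>
     summable (\<lambda>n. pq_summand p q f (- int n - 1))"

definition pq_integral ::
  "real \<Rightarrow> real \<Rightarrow> (real \<Rightarrow> 'a::real_normed_vector) \<Rightarrow> 'a" where
  "pq_integral p q f =
     (p - q) *\<^sub>R
       ((\<Sum>n. pq_summand p q f (int n)) + (\<Sum>n. pq_summand p q f (- int n - 1)))"

definition pq_laplace_integrand ::
  "real \<Rightarrow> real \<Rightarrow> (real \<Rightarrow> complex) \<Rightarrow> real \<Rightarrow> real \<Rightarrow> complex" where
  "pq_laplace_integrand p q f s t = f t * pq_e p q (complex_of_real (- (p * t * s)))"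

definition pq_laplace_converges ::
  "real \<Rightarrow> real \<Rightarrow> (real \<Rightarrow> complex) \<Rightarrow> real \<Rightarrow> bool" where
  "pq_laplace_converges p q f s \<longleftrightarrow> pq_integrable p q (pq_laplace_integrand p q f s)"

definition pq_laplace ::
  "real \<Rightarrow> real \<Rightarrow> (real \<Rightarrow> complex) \<Rightarrow> real \<Rightarrow> complex" where
  "pq_laplace p q f s = pq_integral p q (pq_laplace_integrand p q f s)"

end

theory Submission
  imports Defs
begin

text \<open>Put r = q / p. Comparing coefficients gives the functional equation
  E z = (1 + (1 - r) z) E (r z), and a reciprocal one for the series e; hence
  e z * E (- z) is invariant under scaling by r, and letting the argument shrink to 0 it
  equals 1. The nodes of the integral are t = r^j / p, and the functional
  equation of E makes the sum telescope: with G t = E (a t / r) / E (p s t),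
  (p - q) t E (a t) e (- p t s) = q / (q s - a) * (G (r t) - G t).
  Finally G tends to 1 at 0, and along the nodes going to infinity G tends to 0 because
  the ratio of successive values tends to a / (q s), which has modulus less than 1.\<close>

text \<open>Any \<open>c\<close> strictly between \<open>L\<close> and 1 eventually bounds the
  multipliers. The recurrence replaces quotients of consecutive terms, so terms may vanish.\<close>

lemma summable_ratio_tendsto:
  fixes f g :: "nat \<Rightarrow> 'a :: {real_normed_div_algebra, banach}"
  assumes "\<And>n. f (Suc n) = g n * f n" and "(\<lambda>n. norm (g n)) \<longlonglongrightarrow> L" and "L < 1"
  shows "summable f"
proof -
  obtain c where c: "L < c" "c < 1" using assms(3) dense by blast
  obtain N where N: "\<And>n. n \<ge> N \<Longrightarrow> norm (g n) < c"
    using order_tendstoD(2)[OF assms(2) c(1)] unfolding eventually_sequentially by blast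
  show ?thesis
  proof (rule summable_ratio_test[OF c(2)])
    fix n assume "N \<le> n"
    then show "norm (f (Suc n)) \<le> c * norm (f n)"
      using N[of n] by (simp add: assms(1) norm_mult mult_right_mono)
  qed
qed

context
  fixes p q :: real
  assumes q_pos: "0 < q" and q_less: "q < p"
begin

section \<open>Coefficients and convergence of the two exponential series\<close>

lemma pq_bracket_pos: "0 < pq_bracket p q (Suc n)"
  using q_pos q_less power_strict_mono[of q p "Suc n"] unfolding pq_bracket_def by simp

lemma pq_fact_Suc: "pq_fact p q (Suc n) = pq_bracket p q (Suc n) * pq_fact p q n"
  by (simp add: pq_fact_def)

lemma choose_two_Suc: "Suc n choose 2 = n + (n choose 2)"
  by (simp add: numeral_2_eq_2)

lemma ratio_less_one: "0 < q / p" "q / p < 1"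
  using q_pos q_less by simp_all

lemma ratio_powers_tendsto_zero: "(\<lambda>n. (q / p) ^ n) \<longlonglongrightarrow> 0"
  using ratio_less_one by (intro LIMSEQ_power_zero) simp

text \<open>The limit is the reciprocal of the radius of convergence of the series e.\<close>

lemma p_power_over_bracket:
  "(\<lambda>n. p ^ n / pq_bracket p q (Suc n)) \<longlonglongrightarrow> (p - q) / p"
proof -
  have "(\<lambda>n. (p - q) / p / (1 - (q / p) ^ Suc n)) \<longlonglongrightarrow> (p - q) / p / (1 - 0)"
    by (intro tendsto_divide tendsto_diff tendsto_const LIMSEQ_Suc[OF ratio_powers_tendsto_zero]) simp
  moreover have "p ^ n / pq_bracket p q (Suc n) = (p - q) / p / (1 - (q / p) ^ Suc n)" for n
  proof -
    have "pq_bracket p q (Suc n) = p ^ n * (p / (p - q)) * (1 - (q / p) ^ Suc n)"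
      using q_pos q_less by (simp add: pq_bracket_def power_divide field_simps)
    then show ?thesis using q_pos q_less by simp
  qed
  ultimately show ?thesis by simp
qed

lemma q_power_over_bracket: "(\<lambda>n. q ^ n / pq_bracket p q (Suc n)) \<longlonglongrightarrow> 0"
proof -
  have "(\<lambda>n. (q / p) ^ n * (p ^ n / pq_bracket p q (Suc n))) \<longlonglongrightarrow> 0 * ((p - q) / p)"
    by (intro tendsto_intros ratio_powers_tendsto_zero p_power_over_bracket)
  then show ?thesis using q_pos q_less by (simp add: power_divide)
qed

text \<open>One parameter serves both series: \<open>u = q\<close> gives E and \<open>u = p\<close>
  gives e.\<close>

definition exp_coeff :: "real \<Rightarrow> nat \<Rightarrow> complex" where
  "exp_coeff u n = complex_of_real (u ^ (n choose 2) / pq_fact p q n)"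

lemma exp_coeff_Suc:
  "exp_coeff u (Suc n) = of_real (u ^ n / pq_bracket p q (Suc n)) * exp_coeff u n"
  by (simp add: exp_coeff_def choose_two_Suc pq_fact_Suc power_add)

lemma exp_coeff_0 [simp]: "exp_coeff u 0 = 1"
  by (simp add: exp_coeff_def pq_fact_def binomial_eq_0)

lemma pq_E_eq: "pq_E p q z = (\<Sum>n. exp_coeff q n * z ^ n)"
  by (simp add: pq_E_def exp_coeff_def)

lemma pq_e_series_eq: "pq_e_series p q z = (\<Sum>n. exp_coeff p n * z ^ n)"
  by (simp add: pq_e_series_def exp_coeff_def)

text \<open>Consecutive terms differ by the factor
  \<open>u ^ n / pq_bracket p q (Suc n) * z\<close>, so \<open>L\<close> acts as the reciprocal
  radius: 0 for E, \<open>(p - q) / p\<close> for e.\<close>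

lemma summable_exp_coeff:
  assumes "(\<lambda>n. u ^ n / pq_bracket p q (Suc n)) \<longlonglongrightarrow> L" and "\<bar>L\<bar> * norm z < 1"
  shows "summable (\<lambda>n. exp_coeff u n * z ^ n)"
proof (rule summable_ratio_tendsto)
  show "exp_coeff u (Suc n) * z ^ Suc n
      = (of_real (u ^ n / pq_bracket p q (Suc n)) * z) * (exp_coeff u n * z ^ n)" for n
    by (simp add: exp_coeff_Suc)
  have "(\<lambda>n. \<bar>u ^ n / pq_bracket p q (Suc n)\<bar> * norm z) \<longlonglongrightarrow> \<bar>L\<bar> * norm z"
    by (intro tendsto_intros assms)
  then show "(\<lambda>n. norm (of_real (u ^ n / pq_bracket p q (Suc n)) * z)) \<longlonglongrightarrow> \<bar>L\<bar> * norm z"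
    by (simp only: norm_mult norm_of_real)
qed fact

lemma summable_pq_E: "summable (\<lambda>n. exp_coeff q n * z ^ n)"
  using summable_exp_coeff[OF q_power_over_bracket] by simp

lemma summable_pq_e_series:
  assumes "norm z < p / (p - q)"
  shows "summable (\<lambda>n. exp_coeff p n * z ^ n)"
  using assms q_pos q_less
  by (intro summable_exp_coeff[OF p_power_over_bracket]) (simp add: field_simps)

lemma pq_E_0 [simp]: "pq_E p q 0 = 1"
  unfolding pq_E_eq by (subst powser_zero) simp

lemma isCont_pq_E: "isCont (pq_E p q) z"
  unfolding pq_E_eq[abs_def]
  \<comment> \<open>Any point of modulus larger than \<open>norm z\<close> serves, as the series is
    summable everywhere.\<close>
  by (rule isCont_powser[OF summable_pq_E[of "of_real (norm z + 1)"]])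
    (simp only: norm_of_real; simp)

section \<open>Functional equations under scaling\<close>

lemma exp_coeff_difference:
  "exp_coeff u (Suc n) * of_real (p ^ Suc n - q ^ Suc n)
     = of_real (p - q) * of_real (u ^ n) * exp_coeff u n"
proof -
  have "p ^ Suc n - q ^ Suc n = (p - q) * pq_bracket p q (Suc n)"
    using q_less by (simp add: pq_bracket_def)
  then show ?thesis
    using pq_bracket_pos[of n] by (simp add: exp_coeff_Suc)
qed

text \<open>Divided by \<open>(p - q) * z\<close>, this says that the (p,q)-derivative of f(z) is
  f(u z). The constant terms cancel, and an index shift reduces the rest to
  \<open>exp_coeff_difference\<close>.\<close>

lemma exp_series_difference:
  assumes "summable (\<lambda>n. exp_coeff u n * (of_real p * z) ^ n)"
    and "summable (\<lambda>n. exp_coeff u n * (of_real q * z) ^ n)"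
    and "summable (\<lambda>n. exp_coeff u n * (of_real u * z) ^ n)"
  shows "(\<Sum>n. exp_coeff u n * (of_real p * z) ^ n) - (\<Sum>n. exp_coeff u n * (of_real q * z) ^ n)
     = of_real (p - q) * z * (\<Sum>n. exp_coeff u n * (of_real u * z) ^ n)"
proof -
  let ?d = "\<lambda>n. exp_coeff u n * (of_real p * z) ^ n - exp_coeff u n * (of_real q * z) ^ n"
  have d_Suc: "?d (Suc n)
      = of_real (p - q) * z * (exp_coeff u n * (of_real u * z) ^ n)" for n
  proof -
    have "?d (Suc n)
        = (exp_coeff u (Suc n) * of_real (p ^ Suc n - q ^ Suc n)) * z ^ Suc n"
      by (simp add: power_mult_distrib algebra_simps)
    then show ?thesis
      by (simp only: exp_coeff_difference) (simp add: power_mult_distrib)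
  qed
  have "suminf ?d = (\<Sum>n. ?d (Suc n))"
    using suminf_split_head[OF summable_diff[OF assms(1,2)]] by simp
  also have "\<dots> = of_real (p - q) * z * (\<Sum>n. exp_coeff u n * (of_real u * z) ^ n)"
    unfolding d_Suc by (rule suminf_mult[OF assms(3)])
  finally show ?thesis
    using suminf_diff[OF assms(1,2)] by simp
qed

lemma pq_E_shift:
  "pq_E p q (of_real p * z) = (1 + of_real (p - q) * z) * pq_E p q (of_real q * z)"
proof -
  have *: "x = (1 + c) * y" if "x - y = c * y" for x y c :: complex
    using that by (simp add: algebra_simps)
  show ?thesis
    unfolding pq_E_eq by (intro * exp_series_difference summable_pq_E)
qed

lemma pq_E_of_real_shift:
  "pq_E p q (of_real (p * x)) = of_real (1 + (p - q) * x) * pq_E p q (of_real (q * x))"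
  using pq_E_shift[of "of_real x"] by (simp only: of_real_mult of_real_add of_real_1)

lemma pq_E_functional:
  "pq_E p q z = (1 + of_real ((p - q) / p) * z) * pq_E p q (of_real (q / p) * z)"
proof -
  define y where "y = z / of_real p"
  have "z = of_real p * y" "of_real (q / p) * z = of_real q * y"
    "of_real ((p - q) / p) * z = of_real (p - q) * y"
    using q_pos q_less by (simp_all add: y_def)
  then show ?thesis
    by (metis pq_E_shift)
qed

text \<open>With \<open>u = p\<close>, the right side of the difference equation repeats the value
  at the larger argument. Solving for the value at the smaller one puts the factor on the opposite
  side from its place in \<open>pq_E_functional\<close>.\<close>

lemma pq_e_series_functional:
  assumes "norm z < p / (p - q)"
  shows "pq_e_series p q (of_real (q / p) * z)
    = (1 - of_real ((p - q) / p) * z) * pq_e_series p q z"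
proof -
  define y where "y = z / of_real p"
  have z: "of_real p * y = z" and qz: "of_real q * y = of_real (q / p) * z"
    using q_pos q_less by (simp_all add: y_def)
  have "norm (of_real (q / p) * z) \<le> norm z"
    unfolding norm_mult norm_of_real using ratio_less_one by (intro mult_left_le_one_le) auto
  then have "summable (\<lambda>n. exp_coeff p n * (of_real (q / p) * z) ^ n)"
    using assms by (intro summable_pq_e_series) simp
  then have "pq_e_series p q z - pq_e_series p q (of_real (q / p) * z)
      = of_real (p - q) * y * pq_e_series p q z"
    using exp_series_difference[of p y, unfolded z qz] summable_pq_e_series[OF assms]
    unfolding pq_e_series_eq by (simp only:)
  moreover have "of_real (p - q) * y = of_real ((p - q) / p) * z"
    by (simp add: y_def)
  ultimately have "pq_e_series p q z - pq_e_series p q (of_real (q / p) * z)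
      = of_real ((p - q) / p) * z * pq_e_series p q z"
    by (simp only:)
  moreover have "y = (1 - c) * x" if "x - y = c * x" for x y c :: complex
    using that by (simp add: algebra_simps)
  ultimately show ?thesis
    by (simp only:)
qed

section \<open>The exponentials e and E as reciprocals\<close>

lemma ratio_orbit_tendsto_zero: "(\<lambda>n. of_real ((q / p) ^ n) * (z :: complex)) \<longlonglongrightarrow> 0"
  using tendsto_mult[OF tendsto_of_real[OF ratio_powers_tendsto_zero] tendsto_const[of z]]
  by simp

lemma pq_e_series_times_pq_E:
  assumes "norm z < p / (p - q)"
  shows "pq_e_series p q z * pq_E p q (- z) = 1"
proof -
  define w where "w n = complex_of_real ((q / p) ^ n) * z" for n
  let ?h = "\<lambda>x. pq_e_series p q x * pq_E p q (- x)"
  have w_Suc: "w (Suc n) = of_real (q / p) * w n" for n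
    by (simp add: w_def)
  \<comment> \<open>The factor gained by e at the scaled point is the one that E loses
    there.\<close>
  have invariant: "?h (of_real (q / p) * x) = ?h x" if "norm x < p / (p - q)" for x
    using pq_e_series_functional[OF that] pq_E_functional[of "- x"] by simp
  have "norm (w n) < p / (p - q)" for n
  proof -
    have "(q / p) ^ n \<le> 1" "0 \<le> (q / p) ^ n"
      using ratio_less_one by (intro power_le_one zero_le_power; simp)+
    then have "norm (w n) \<le> norm z"
      unfolding w_def norm_mult norm_of_real by (simp add: mult_left_le_one_le del: power_divide)
    then show ?thesis using assms by simp
  qed
  then have "?h (w n) = ?h z" for n
    by (induction n) (simp_all only: w_Suc invariant, simp add: w_def)
  moreover have "(\<lambda>n. ?h (w n)) \<longlonglongrightarrow> ?h 0"
  proof (rule isCont_tendsto_compose[where g = ?h])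
    show "w \<longlonglongrightarrow> 0" unfolding w_def[abs_def] by (rule ratio_orbit_tendsto_zero)
    \<comment> \<open>Since \<open>p / (p - q)\<close> exceeds 1, the series e is summable at 1,
      which gives continuity at all points of smaller modulus, in particular at 0.\<close>
    have "norm (complex_of_real 1) < p / (p - q)"
      using q_pos q_less by simp
    then have "isCont (pq_e_series p q) 0"
      unfolding pq_e_series_eq[abs_def]
      by (intro isCont_powser[OF summable_pq_e_series[of "complex_of_real 1"]]) auto
    then show "isCont ?h 0"
      using isCont_o2[OF isCont_minus[OF continuous_ident] isCont_pq_E] by (intro continuous_intros)
  qed
  ultimately have "?h z = ?h 0"
    by (simp add: LIMSEQ_const_iff)
  also have "pq_e_series p q 0 = 1"
    unfolding pq_e_series_eq by (subst powser_zero) simp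
  finally show ?thesis by simp
qed

text \<open>Inside the disc the product with \<open>pq_E p q (- z)\<close> is 1, so that factor is
  nonzero and can be divided out; outside, this is the definition.\<close>

lemma pq_e_eq_inverse: "pq_e p q z = 1 / pq_E p q (- z)"
  using pq_e_series_times_pq_E[of z] by (auto simp: pq_e_def divide_simps)

section \<open>Telescoping of the Laplace integrand\<close>

definition laplace_primitive :: "real \<Rightarrow> real \<Rightarrow> real \<Rightarrow> complex" where
  "laplace_primitive a s t = pq_E p q (of_real (p * (a * t / q))) / pq_E p q (of_real (p * (s * t)))"

text \<open>One shift of E strips a linear factor from the numerator and one from the denominator.
  The numerator argument carries \<open>p / q\<close> so that the shift leads to
  \<open>a * t\<close>, the argument in the integrand.\<close>

lemma laplace_primitive_step:
  assumes "0 < s" and "0 < t"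
  shows "of_real (1 + (p - q) * (s * t)) * laplace_primitive a s t
    = of_real (1 + (p - q) * (a * t / q)) * laplace_primitive a s (q / p * t)"
proof -
  have num: "pq_E p q (of_real (p * (a * t / q)))
      = of_real (1 + (p - q) * (a * t / q)) * pq_E p q (of_real (a * t))"
    using pq_E_of_real_shift[of "a * t / q"] q_pos by simp
  have den: "pq_E p q (of_real (p * (s * t)))
      = of_real (1 + (p - q) * (s * t)) * pq_E p q (of_real (q * (s * t)))"
    by (rule pq_E_of_real_shift)
  have "0 < 1 + (p - q) * (s * t)"
    using q_less assms by (simp add: add_pos_pos)
  then have "complex_of_real (1 + (p - q) * (s * t)) \<noteq> 0"
    by (simp only: of_real_eq_0_iff)
  moreover have "laplace_primitive a s (q / p * t)
      = pq_E p q (of_real (a * t)) / pq_E p q (of_real (q * (s * t)))"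
    using q_pos q_less by (simp add: laplace_primitive_def mult_ac)
  ultimately show ?thesis
    unfolding laplace_primitive_def num den by simp
qed

text \<open>With \<open>X\<close> the primitive at \<open>q / p * t\<close>, the integrand is
  \<open>X / u\<close>, and the primitive at \<open>t\<close> is \<open>v * X / u\<close>. This
  leaves the scalar identity \<open>t / u = K * (1 - v / u)\<close>. The division by
  \<open>p - q\<close> in \<open>K\<close> will cancel the prefactor of the integral.\<close>

lemma laplace_integrand_telescopes:
  assumes "0 < s" and "0 < t" and "a \<noteq> q * s"
  shows "t *\<^sub>R pq_laplace_integrand p q (\<lambda>t. pq_E p q (of_real (a * t))) s t
    = of_real (q / (q * s - a) / (p - q))
      * (laplace_primitive a s (q / p * t) - laplace_primitive a s t)"
proof -
  define u where "u = 1 + (p - q) * (s * t)"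
  define v where "v = 1 + (p - q) * (a * t / q)"
  have u_pos: "0 < u"
    using q_less assms by (simp add: u_def add_pos_pos)
  define K where "K = q / (q * s - a) / (p - q)"
  define X where "X = laplace_primitive a s (q / p * t)"
  have "pq_E p q (of_real (p * (s * t))) = of_real u * pq_E p q (of_real (q * (s * t)))"
    unfolding u_def by (rule pq_E_of_real_shift)
  then have "pq_laplace_integrand p q (\<lambda>t. pq_E p q (of_real (a * t))) s t = X / of_real u"
    using q_pos q_less u_pos
    by (simp add: pq_laplace_integrand_def pq_e_eq_inverse X_def laplace_primitive_def mult_ac)
  moreover have "of_real u * laplace_primitive a s t = of_real v * X"
    unfolding X_def u_def v_def by (rule laplace_primitive_step[OF assms(1,2)])
  then have "laplace_primitive a s t = of_real v * X / of_real u"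
    using u_pos by (simp add: field_simps)
  moreover have "t / u = q / (q * s - a) / (p - q) * (1 - v / u)"
  proof -
    have "u - v = (p - q) * t * (q * s - a) / q"
      using q_pos by (simp add: u_def v_def field_simps)
    then have "1 - v / u = (p - q) * t * (q * s - a) / q / u"
      using u_pos by (simp add: field_simps)
    then show ?thesis
      using q_pos q_less assms by simp
  qed
  then have "complex_of_real (t / u) = of_real K * (1 - of_real v / of_real u)"
    unfolding K_def[symmetric] by simp
  then have "of_real (t / u) * X = of_real K * (1 - of_real v / of_real u) * X"
    by (rule arg_cong)
  then have "of_real t * (X / of_real u) = of_real K * (X - of_real v * X / of_real u)"
    by (simp add: algebra_simps)
  ultimately show ?thesis
    by (simp only: X_def[symmetric] K_def[symmetric] scaleR_conv_of_real)
qed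

section \<open>Nodes of the integral and limits of the primitive along them\<close>

lemma pq_node_pos: "0 < pq_node p q j"
  using q_pos q_less by (simp add: pq_node_def)

lemma pq_node_eq: "pq_node p q j = (q / p) powi j / p"
proof -
  have "p powi (j + 1) = p powi j * p"
    using q_pos q_less by (intro power_int_add_1) simp
  then show ?thesis
    by (simp add: pq_node_def power_int_divide_distrib)
qed

lemma pq_node_Suc: "pq_node p q (j + 1) = q / p * pq_node p q j"
proof -
  have "(q / p) powi (j + 1) = (q / p) powi j * (q / p)"
    using q_pos q_less by (intro power_int_add_1) simp
  then show ?thesis
    by (simp add: pq_node_eq)
qed

lemma pq_node_nat: "pq_node p q (int n) = (q / p) ^ n / p"
  by (simp add: pq_node_eq)

lemma pq_node_minus_nat: "pq_node p q (- int n) = inverse ((q / p) ^ n * p)"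
  by (simp add: pq_node_eq power_int_minus divide_inverse)

text \<open>Both arguments of E shrink to 0 with the nodes, and E is continuous there with value
  1.\<close>

lemma laplace_primitive_tendsto_one:
  "(\<lambda>n. laplace_primitive a s (pq_node p q (int n))) \<longlonglongrightarrow> 1"
proof -
  have "(\<lambda>n. pq_node p q (int n)) \<longlonglongrightarrow> 0"
    using tendsto_divide[OF ratio_powers_tendsto_zero tendsto_const[of p]] q_pos q_less
    by (simp add: pq_node_nat)
  then have lim: "(\<lambda>n. complex_of_real (c * pq_node p q (int n))) \<longlonglongrightarrow> 0" for c
    using tendsto_of_real[OF tendsto_mult[OF tendsto_const[of c]]] by fastforce
  have "(\<lambda>n. pq_E p q (of_real (a * p / q * pq_node p q (int n)))
        / pq_E p q (of_real (p * s * pq_node p q (int n)))) \<longlonglongrightarrow> pq_E p q 0 / pq_E p q 0"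
    by (intro tendsto_divide isCont_tendsto_compose[OF isCont_pq_E] lim) simp
  then show ?thesis
    by (simp add: laplace_primitive_def mult_ac)
qed

text \<open>Instead of estimating E at infinity, the values are read as terms of a series; the ratio
  test makes it summable, so its terms tend to 0.\<close>

lemma laplace_primitive_tendsto_zero:
  assumes "0 < s" and "\<bar>a / q\<bar> < s"
  shows "(\<lambda>n. laplace_primitive a s (pq_node p q (- int n))) \<longlonglongrightarrow> 0"
proof (rule summable_LIMSEQ_zero, rule summable_ratio_tendsto)
  \<comment> \<open>The shift by one makes \<open>y n\<close> the node following that of index
    \<open>- int n\<close>: the recurrence expresses the value at the larger node through the one at
    the smaller.\<close>
  define y where "y n = pq_node p q (- int (Suc n))" for n
  define \<rho> where "\<rho> n = (1 + (p - q) * (a * y n / q)) / (1 + (p - q) * (s * y n))" for n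
  have y_pos: "0 < y n" for n
    by (simp add: y_def pq_node_pos)
  have pos: "0 < 1 + (p - q) * (s * y n)" for n
    using q_less assms(1) y_pos[of n] by (simp add: add_pos_pos)
  show "laplace_primitive a s (pq_node p q (- int (Suc n)))
      = of_real (\<rho> n) * laplace_primitive a s (pq_node p q (- int n))" for n
  proof -
    have "q / p * y n = pq_node p q (- int n)"
      using pq_node_Suc[of "- int (Suc n)"] by (simp add: y_def)
    then have "of_real (1 + (p - q) * (s * y n)) * laplace_primitive a s (y n)
        = of_real (1 + (p - q) * (a * y n / q)) * laplace_primitive a s (pq_node p q (- int n))"
      using laplace_primitive_step[OF assms(1) y_pos] by metis
    moreover have "complex_of_real (1 + (p - q) * (s * y n)) \<noteq> 0"
      using pos[of n] by (simp only: of_real_eq_0_iff)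
    ultimately show ?thesis
      unfolding \<rho>_def y_def[symmetric] of_real_divide
      by (metis nonzero_mult_div_cancel_left times_divide_eq_left)
  qed
  \<comment> \<open>The nodes \<open>y n\<close> grow without bound, so once \<open>y n\<close> is
    cancelled from both parts of \<open>\<rho> n\<close>, only its coefficients survive in the
    limit.\<close>
  have "(\<lambda>n. inverse (y n)) \<longlonglongrightarrow> 0"
    using tendsto_mult[OF LIMSEQ_Suc[OF ratio_powers_tendsto_zero] tendsto_const[of p]]
    unfolding y_def pq_node_minus_nat by simp
  then have "(\<lambda>n. (inverse (y n) + (p - q) * a / q) / (inverse (y n) + (p - q) * s))
      \<longlonglongrightarrow> (0 + (p - q) * a / q) / (0 + (p - q) * s)"
    using q_less assms(1) by (intro tendsto_intros) auto
  moreover have "(inverse (y n) + (p - q) * a / q) / (inverse (y n) + (p - q) * s) = \<rho> n" for n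
  proof -
    have "\<rho> n = (y n * (inverse (y n) + (p - q) * a / q)) / (y n * (inverse (y n) + (p - q) * s))"
      using y_pos[of n] by (simp add: \<rho>_def algebra_simps)
    then show ?thesis using y_pos[of n] by simp
  qed
  ultimately have "\<rho> \<longlonglongrightarrow> a / q / s"
    using q_less by simp
  then show "(\<lambda>n. norm (complex_of_real (\<rho> n))) \<longlonglongrightarrow> \<bar>a / q / s\<bar>"
    unfolding norm_of_real by (rule tendsto_rabs)
  have "\<bar>a / q / s\<bar> = \<bar>a / q\<bar> / s"
    using assms(1) abs_divide[of "a / q" s] by simp
  then show "\<bar>a / q / s\<bar> < 1"
    using assms by (simp only: divide_less_eq_1_pos)
qed

text \<open>The halves meet at the node \<open>1 / p\<close> of index 0, where the primitive equals
  \<open>g\<close>; the outer ends contribute the limits 1 and 0.\<close>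

lemma laplace_sums:
  fixes a s :: real
  defines "f \<equiv> pq_laplace_integrand p q (\<lambda>t. pq_E p q (of_real (a * t))) s"
    and "C \<equiv> complex_of_real (q / (q * s - a) / (p - q))"
    and "g \<equiv> laplace_primitive a s (1 / p)"
  assumes "0 < s" and "\<bar>a / q\<bar> < s"
  shows "(\<lambda>n. pq_summand p q f (int n)) sums (C * (1 - g))"
    and "(\<lambda>n. pq_summand p q f (- int n - 1)) sums (C * g)"
proof -
  define G where "G j = laplace_primitive a s (pq_node p q j)" for j
  \<comment> \<open>Equality would force \<open>\<bar>a / q\<bar> = s\<close>.\<close>
  have "a \<noteq> q * s"
    using q_pos assms(4,5) by auto
  then have summand: "pq_summand p q f j = C * (G (j + 1) - G j)" for j
    unfolding pq_summand_def f_def C_def G_def pq_node_Suc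
    using assms(4) pq_node_pos by (intro laplace_integrand_telescopes)
  have G_0: "G 0 = g"
    by (simp add: G_def g_def pq_node_def)
  have "(\<lambda>n. G (int (Suc n)) - G (int n)) sums (1 - G (int 0))"
    unfolding G_def by (intro telescope_sums laplace_primitive_tendsto_one)
  then show "(\<lambda>n. pq_summand p q f (int n)) sums (C * (1 - g))"
    unfolding summand by (intro sums_mult) (simp add: G_0 add.commute)
  \<comment> \<open>For negative indices the telescope runs from \<open>G 0\<close> outwards to the
    limit 0.\<close>
  have "(\<lambda>n. G (- int n) - G (- int (Suc n))) sums (G (- int 0) - 0)"
    unfolding G_def by (intro telescope_sums' laplace_primitive_tendsto_zero assms)
  moreover have "pq_summand p q f (- int n - 1) = C * (G (- int n) - G (- int (Suc n)))" for n
  proof -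
    have "- int n - 1 = - int (Suc n)" "- int (Suc n) + 1 = - int n"
      by simp_all
    then show ?thesis by (simp only: summand)
  qed
  ultimately show "(\<lambda>n. pq_summand p q f (- int n - 1)) sums (C * g)"
    using sums_mult[of _ "G (- int 0) - 0" C] by (simp only: G_0 of_nat_0 minus_zero diff_zero)
qed

end

theorem proposition3p7:
  fixes p q a s :: real
  assumes "0 < q" and "q < p" and "s > 0" and "s > \<bar>a / q\<bar>"
  shows "pq_laplace_converges p q (\<lambda>t. pq_E p q (complex_of_real (a * t))) s \<and>
         pq_laplace p q (\<lambda>t. pq_E p q (complex_of_real (a * t))) s
           = complex_of_real (q / (q * s - a))"
proof -
  define C where "C = complex_of_real (q / (q * s - a) / (p - q))"
  note sums = laplace_sums[OF assms, folded C_def]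
  \<comment> \<open>The contributions of the common node cancel when the two halves are
    added.\<close>
  have "pq_laplace p q (\<lambda>t. pq_E p q (complex_of_real (a * t))) s = (p - q) *\<^sub>R C"
    using sums[THEN sums_unique, symmetric]
    unfolding pq_laplace_def pq_integral_def by (simp add: algebra_simps)
  also have "\<dots> = complex_of_real ((p - q) * (q / (q * s - a) / (p - q)))"
    unfolding C_def scaleR_conv_of_real of_real_mult ..
  also have "(p - q) * (q / (q * s - a) / (p - q)) = q / (q * s - a)"
    using assms(2) by simp
  finally show ?thesis
    using sums[THEN sums_summable]
    unfolding pq_laplace_converges_def pq_integrable_def by simp
qed

end
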